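(* For every positive integer $N$ there exists a connected graph $G$ with finite multiset dimension $\mathrm{md}(G)$ and finite multiset partition dimension $\mathrm{mpd}(G)$ such that $|\mathrm{mpd}(G)-\mathrm{md}(G)|\ge N$.
   Context: Graphs are finite, simple and undirected; $d(u,v)$ denotes the shortest-path distance. Let $G$ be a connected graph. Multiset dimension (also called multiset metric dimension): for $W\subseteq V(G)$ and $v\in V(G)$ let $r_m(v\mid W)=\{d(v,w):w\in W\}$, considered as a multiset. $W$ is a multiset resolving set if $r_m(u\mid W)\ne r_m(v\mid W)$ for all distinct $u,v\in V(G)$. $\mathrm{md}(G)$ is the minimum cardinality of a multiset resolving set, and is infinite if none exists. Multiset partition dimension: let $\Pi=\{S_1,\dots,S_t\}$ be a partition of $V(G)$ into nonempty parts. For $v\in V(G)$ put $d(v,S_i)=\min\{d(v,x):x\in S_i\}$ and let $r_{mp}(v\mid\Pi)$ be the multiset $\{d(v,S_1),\dots,d(v,S_t)\}$. $\Pi$ is a resolving multiset partition if $r_{mp}(u\mid\Pi)\ne r_{mp}(v\mid\Pi)$ for all distinct $u,v\in V(G)$. $\mathrm{mpd}(G)$ is the minimum number $t$ of parts of a resolving multiset partition of $G$, and $\mathrm{mpd}(G)=\infty$ if none exists. *)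

theory Defs
  imports
    "Graph_Theory.Pair_Digraph"
    "Graph_Theory.Digraph_Component"
    "Graph_Theory.Shortest_Path"
    "HOL-Library.Multiset"
    "HOL-Library.Disjoint_Sets"
    "HOL-Library.Extended_Nat"
begin

text \<open>
  Finite simple undirected graphs are rendered by the locale \<open>pair_graph\<close>, that is, by finite
  loop-free symmetric digraphs whose arcs are pairs of vertices. The shortest-path distance is
  \<open>wf_digraph.\<mu>\<close> with unit arc weights; it is extended-real valued, with \<open>\<infinity>\<close> for unreachable
  vertices, so on a connected graph all its values are natural numbers.
\<close>

definition gdist :: "('a, 'b) pre_digraph \<Rightarrow> 'a \<Rightarrow> 'a \<Rightarrow> ereal" where
  "gdist G u v = wf_digraph.\<mu> G (\<lambda>_. 1) u v"

lemma gdist_eq_INF_length: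
  assumes "wf_digraph G"
  shows "gdist G u v = (INF p \<in> {p. pre_digraph.awalk G u p v}. ereal (real (length p)))"
proof -
  interpret wf_digraph G by fact
  have "awalk_cost (\<lambda>_. 1) p = real (length p)" for p
    by (induction p) simp_all
  then show ?thesis
    by (simp add: gdist_def \<mu>_def)
qed

definition multiset_code :: "('a, 'b) pre_digraph \<Rightarrow> 'a set \<Rightarrow> 'a \<Rightarrow> ereal multiset" where
  "multiset_code G W v = image_mset (\<lambda>w. gdist G v w) (mset_set W)"

definition multiset_resolving :: "('a, 'b) pre_digraph \<Rightarrow> 'a set \<Rightarrow> bool" where
  "multiset_resolving G W \<longleftrightarrow> W \<subseteq> verts G \<and>
     (\<forall>u\<in>verts G. \<forall>v\<in>verts G. u \<noteq> v \<longrightarrow> multiset_code G W u \<noteq> multiset_code G W v)"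

text \<open>The infimum of the empty set in \<^typ>\<open>enat\<close> is \<open>\<infinity>\<close>; that of a nonempty set is attained.\<close>

definition md :: "('a, 'b) pre_digraph \<Rightarrow> enat" where
  "md G = (INF W \<in> {W. multiset_resolving G W}. enat (card W))"

definition gdist_set :: "('a, 'b) pre_digraph \<Rightarrow> 'a \<Rightarrow> 'a set \<Rightarrow> ereal" where
  "gdist_set G v S = Min ((\<lambda>x. gdist G v x) ` S)"

definition partition_code :: "('a, 'b) pre_digraph \<Rightarrow> 'a set set \<Rightarrow> 'a \<Rightarrow> ereal multiset" where
  "partition_code G P v = image_mset (\<lambda>S. gdist_set G v S) (mset_set P)"

definition resolving_multiset_partition :: "('a, 'b) pre_digraph \<Rightarrow> 'a set set \<Rightarrow> bool" where
  "resolving_multiset_partition G P \<longleftrightarrow> partition_on (verts G) P \<and>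
     (\<forall>u\<in>verts G. \<forall>v\<in>verts G. u \<noteq> v \<longrightarrow> partition_code G P u \<noteq> partition_code G P v)"

definition mpd :: "('a, 'b) pre_digraph \<Rightarrow> enat" where
  "mpd G = (INF P \<in> {P. resolving_multiset_partition G P}. enat (card P))"

end

theory Submission
  imports Defs
begin

text \<open>
  The graph is a caterpillar: a path \<open>0, \<dots>, 2p+1\<close> with two leaves attached to each of the vertices
  \<open>2, \<dots>, p\<close>. Two leaves with the same neighbour are equidistant from every other vertex, so a
  multiset resolving set meets each of the \<open>p - 1\<close> pairs of twins, and the multiset dimension is at
  least \<open>p - 1\<close>; it is finite because the path together with one leaf of each pair is resolving. A
  partition can separate twins much more cheaply, by putting only one of them into the part of
  their common neighbour. Four parts suffice: the two ends of the path, one leaf of each pair, and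
  all the rest.
\<close>

section \<open>Graphs given by their distance function\<close>

text \<open>A graph is specified here by its metric, with adjacency meaning distance 1.
  \<open>D_triangle\<close> bounds the length of walks from below and \<open>D_step\<close> yields
  walks attaining the bound, so \<open>D\<close> is the shortest-path distance.\<close>

locale distance_graph =
  fixes V :: "'a set" and D :: "'a \<Rightarrow> 'a \<Rightarrow> nat"
  assumes finite_V: "finite V" and nonempty_V: "V \<noteq> {}"
    and D_eq_0_iff: "\<And>u v. D u v = 0 \<longleftrightarrow> u = v"
    and D_commute: "\<And>u v. D u v = D v u"
    and D_triangle: "\<And>u v w. D u w \<le> D u v + D v w"
    and D_step: "\<And>u v. u \<in> V \<Longrightarrow> v \<in> V \<Longrightarrow> u \<noteq> v \<Longrightarrow> \<exists>w\<in>V. D u w = 1 \<and> D u v = Suc (D w v)"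
begin

definition G :: "'a pair_pre_digraph" where
  "G = \<lparr>pverts = V, parcs = {(u, v). u \<in> V \<and> v \<in> V \<and> D u v = 1}\<rparr>"

lemma pverts_G [simp]: "pverts G = V"
  and parcs_G: "parcs G = {(u, v). u \<in> V \<and> v \<in> V \<and> D u v = 1}"
  by (simp_all add: G_def)

lemma pair_graph_G: "pair_graph G"
proof
  have "parcs G \<subseteq> V \<times> V" by (auto simp: parcs_G)
  then show "finite (parcs G)" using finite_V by (blast intro: finite_subset)
  show "symmetric (with_proj G)"
    by (auto simp: symmetric_def parcs_G sym_def D_commute)
  show "fst e \<noteq> snd e" if "e \<in> parcs G" for e
    using that D_eq_0_iff[of "fst e" "snd e"] by (auto simp: parcs_G)
qed (auto simp: parcs_G finite_V)

sublocale pair_graph G by (rule pair_graph_G)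

lemma ex_awalk_length_D:
  assumes "u \<in> V" "v \<in> V"
  shows "\<exists>p. awalk u p v \<and> length p = D u v"
  using assms
proof (induction "D u v" arbitrary: u)
  case 0
  then show ?case
    using D_eq_0_iff[of u v] by (auto intro!: exI[of _ "[]"] simp: awalk_Nil_iff)
next
  case (Suc n)
  then have "u \<noteq> v" using D_eq_0_iff[of u v] by auto
  then obtain w where w: "w \<in> V" "D u w = 1" "D u v = Suc (D w v)"
    using D_step Suc.prems by blast
  then obtain p where "awalk w p v" "length p = D w v"
    using Suc by fastforce
  then have "awalk u ((u, w) # p) v \<and> length ((u, w) # p) = D u v"
    using w Suc.prems by (simp add: awalk_Cons_iff parcs_G)
  then show ?case by blast
qed

lemma D_le_length_awalk: "awalk u p v \<Longrightarrow> D u v \<le> length p"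
proof (induction p arbitrary: u)
  case Nil
  then show ?case using D_eq_0_iff[of u v] by (simp add: awalk_Nil_iff)
next
  case (Cons e p)
  then have "D u (snd e) = 1" "D (snd e) v \<le> length p"
    by (auto simp: awalk_Cons_iff parcs_G)
  with D_triangle[of u v "snd e"] show ?case by simp
qed

lemma gdist_G:
  assumes "u \<in> V" "v \<in> V"
  shows "gdist G u v = ereal (D u v)"
proof -
  obtain p where "awalk u p v" "length p = D u v"
    using ex_awalk_length_D[OF assms] by blast
  then have "(INF p \<in> {p. awalk u p v}. ereal (length p)) = D u v"
    by (intro antisym INF_lower2[of p] INF_greatest) (auto intro: D_le_length_awalk)
  then show ?thesis
    by (simp add: gdist_eq_INF_length[OF wf_digraph_axioms])
qed

lemma connected_G: "connected G"
proof -
  have "u \<rightarrow>\<^sup>*\<^bsub>with_proj G\<^esub> v" if "u \<in> V" "v \<in> V" for u v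
    using ex_awalk_length_D[OF that] reachable_awalk by blast
  then show ?thesis
    unfolding connected_def
    using nonempty_V reachable_mk_symmetric_eq[OF pair_sym_arcs] by (auto simp: strongly_connected_def)
qed

text \<open>The embedding of \<open>nat\<close> into \<open>ereal\<close> is injective, so codes can
  be compared as multisets of naturals.\<close>

lemma image_mset_ereal_of_nat_eq_iff:
  "image_mset (\<lambda>x. ereal (f x)) A = image_mset (\<lambda>x. ereal (g x)) A \<longleftrightarrow> image_mset f A = image_mset g A"
  for f g :: "'b \<Rightarrow> nat"
proof -
  have "inj (image_mset (\<lambda>n::nat. ereal n))"
    by (intro multiset.inj_map injI) simp
  from inj_eq[OF this, of "image_mset f A" "image_mset g A"] show ?thesis
    by (simp add: multiset.map_comp comp_def)
qed

lemma multiset_code_G_eq_iff: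
  assumes "W \<subseteq> V" "u \<in> V" "v \<in> V"
  shows "multiset_code G W u = multiset_code G W v
     \<longleftrightarrow> image_mset (D u) (mset_set W) = image_mset (D v) (mset_set W)"
proof -
  have "finite W" using assms(1) finite_V by (rule finite_subset)
  then have "multiset_code G W x = image_mset (\<lambda>w. ereal (D x w)) (mset_set W)" if "x \<in> V" for x
    unfolding multiset_code_def using that assms(1) by (intro image_mset_cong) (auto simp: gdist_G)
  then show ?thesis using assms by (simp add: image_mset_ereal_of_nat_eq_iff)
qed

lemma partition_code_G_eq_iff:
  assumes P: "partition_on V P" and "u \<in> V" "v \<in> V"
  shows "partition_code G P u = partition_code G P v
     \<longleftrightarrow> image_mset (\<lambda>S. Min (D u ` S)) (mset_set P) = image_mset (\<lambda>S. Min (D v ` S)) (mset_set P)"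
proof -
  have "finite P" using P finite_V by (rule finite_elements[rotated])
  have "gdist_set G x S = ereal (Min (D x ` S))" if "x \<in> V" "S \<in> P" for x S
  proof -
    have S: "finite S" "S \<noteq> {}" "S \<subseteq> V"
      using P that(2) finite_V by (auto simp: partition_on_def intro: finite_subset)
    then have "(\<lambda>y. gdist G x y) ` S = (\<lambda>n::nat. ereal n) ` D x ` S"
      using that(1) by (force simp: gdist_G image_image intro!: image_cong)
    moreover have "Min ((\<lambda>n::nat. ereal n) ` D x ` S) = ereal (Min (D x ` S))"
      using S by (intro mono_Min_commute[symmetric]) (auto simp: mono_def)
    ultimately show ?thesis by (simp add: gdist_set_def)
  qed
  then have "partition_code G P x = image_mset (\<lambda>S. ereal (Min (D x ` S))) (mset_set P)"
    if "x \<in> V" for x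
    unfolding partition_code_def using that \<open>finite P\<close> by (intro image_mset_cong) auto
  then show ?thesis using assms by (simp add: image_mset_ereal_of_nat_eq_iff)
qed

end


section \<open>The caterpillar\<close>

text \<open>The vertex \<open>x\<close> of the path is encoded as \<open>3x\<close>, and the two leaves at \<open>i\<close> as \<open>3i + 1\<close> and \<open>3i + 2\<close>.\<close>

definition sp :: "nat \<Rightarrow> nat" where "sp x = 3 * x"
definition la :: "nat \<Rightarrow> nat" where "la i = 3 * i + 1"
definition lb :: "nat \<Rightarrow> nat" where "lb i = 3 * i + 2"

definition height :: "nat \<Rightarrow> nat" where "height v = (if v mod 3 = 0 then 0 else 1)"

text \<open>\<open>height\<close> is the distance to the path, and the two truncated differences add
  up to the absolute difference of positions. Without the case \<open>u = v\<close> a leaf would be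
  at distance 2 from itself.\<close>

definition cdist :: "nat \<Rightarrow> nat \<Rightarrow> nat" where
  "cdist u v = (if u = v then 0
     else (u div 3 - v div 3) + (v div 3 - u div 3) + height u + height v)"

lemma div_mod_simps:
  "sp x div 3 = x" "la x div 3 = x" "lb x div 3 = x"
  "height (sp x) = 0" "height (la x) = 1" "height (lb x) = 1"
  unfolding sp_def la_def lb_def height_def by (simp_all, presburger+)

lemma vertex_eq_simps [simp]:
  "sp x = sp y \<longleftrightarrow> x = y" "la x = la y \<longleftrightarrow> x = y" "lb x = lb y \<longleftrightarrow> x = y"
  "sp x \<noteq> la y" "sp x \<noteq> lb y" "la x \<noteq> sp y" "la x \<noteq> lb y" "lb x \<noteq> sp y" "lb x \<noteq> la y"
  unfolding sp_def la_def lb_def by presburger+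

lemma cdist_simps [simp]:
  "cdist (sp x) (sp y) = (x - y) + (y - x)"
  "cdist (sp x) (la y) = (x - y) + (y - x) + 1"
  "cdist (sp x) (lb y) = (x - y) + (y - x) + 1"
  "cdist (la x) (sp y) = (x - y) + (y - x) + 1"
  "cdist (la x) (la y) = (if x = y then 0 else (x - y) + (y - x) + 2)"
  "cdist (la x) (lb y) = (x - y) + (y - x) + 2"
  "cdist (lb x) (sp y) = (x - y) + (y - x) + 1"
  "cdist (lb x) (la y) = (x - y) + (y - x) + 2"
  "cdist (lb x) (lb y) = (if x = y then 0 else (x - y) + (y - x) + 2)"
  by (simp_all add: cdist_def div_mod_simps)

lemma vertex_cases: obtains x where "v = sp x" | x where "v = la x" | x where "v = lb x"
proof -
  have "v = sp (v div 3) \<or> v = la (v div 3) \<or> v = lb (v div 3)"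
    unfolding sp_def la_def lb_def by presburger
  then show ?thesis using that by blast
qed

lemma cdist_eq_0_iff: "cdist u v = 0 \<longleftrightarrow> u = v"
  by (cases u rule: vertex_cases; cases v rule: vertex_cases) auto

lemma cdist_commute: "cdist u v = cdist v u"
  by (simp add: cdist_def)

lemma cdist_triangle: "cdist u w \<le> cdist u v + cdist v w"
proof -
  define e :: "nat \<Rightarrow> nat \<Rightarrow> nat" where "e a b = (a - b) + (b - a)" for a b
  have "e a c \<le> e a b + e b c" for a b c
    unfolding e_def by linarith
  note this[of "u div 3" "w div 3" "v div 3"]
  moreover have "cdist x y = (if x = y then 0 else e (x div 3) (y div 3) + height x + height y)" for x y
    by (simp add: cdist_def e_def)
  ultimately show ?thesis by simp
qed

text \<open>The bound 6 puts the positions \<open>p + 1\<close> to \<open>p + 3\<close> inside the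
  path, at distance at least 4 from its far end; this excludes small entries when codes are
  compared.\<close>

locale caterpillar =
  fixes p :: nat
  assumes p_ge: "6 \<le> p"
begin

abbreviation L :: nat where "L \<equiv> 2 * p + 1"

text \<open>Since \<open>p < L - p\<close>, all leaves hang in the first half. Starting at 2 keeps
  every leaf at distance less than \<open>L\<close> from both ends.\<close>

definition V :: "nat set" where
  "V = sp ` {..L} \<union> la ` {2..p} \<union> lb ` {2..p}"

lemma V_cases [consumes 1, case_names sp la lb]:
  assumes "v \<in> V"
  obtains x where "x \<le> L" "v = sp x"
    | i where "2 \<le> i" "i \<le> p" "v = la i"
    | i where "2 \<le> i" "i \<le> p" "v = lb i"
  using assms by (auto simp: V_def)

lemma in_V [simp]:
  "sp x \<in> V \<longleftrightarrow> x \<le> L" "la x \<in> V \<longleftrightarrow> 2 \<le> x \<and> x \<le> p" "lb x \<in> V \<longleftrightarrow> 2 \<le> x \<and> x \<le> p"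
  by (auto simp: V_def)

lemma cdist_step:
  assumes "u \<in> V" "v \<in> V" "u \<noteq> v"
  shows "\<exists>w\<in>V. cdist u w = 1 \<and> cdist u v = Suc (cdist w v)"
  using assms(1)
proof (cases u rule: V_cases)
  case (sp x)
  show ?thesis
  proof (cases "v div 3" x rule: linorder_cases)
    case less
    with assms(2,3) sp show ?thesis
      by (intro bexI[of _ "sp (x - 1)"]) (auto elim!: V_cases simp: div_mod_simps)
  next
    case greater
    with assms(2,3) sp show ?thesis
      by (intro bexI[of _ "sp (x + 1)"]) (auto elim!: V_cases simp: div_mod_simps)
  next
    \<comment> \<open>Here \<open>v\<close> is a leaf at \<open>x\<close>, hence itself the
      neighbour to move to.\<close>
    case equal
    with assms(2,3) sp show ?thesis
      by (intro bexI[of _ v]) (auto elim!: V_cases simp: div_mod_simps)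
  qed
next
  case (la i)
  with assms(2,3) show ?thesis
    by (intro bexI[of _ "sp i"]) (auto elim!: V_cases)
next
  case (lb i)
  with assms(2,3) show ?thesis
    by (intro bexI[of _ "sp i"]) (auto elim!: V_cases)
qed

sublocale distance_graph V cdist
proof
  show "finite V" by (simp add: V_def)
  have "sp 0 \<in> V" by simp
  then show "V \<noteq> {}" by blast
  show "\<exists>w\<in>V. cdist u w = 1 \<and> cdist u v = Suc (cdist w v)" if "u \<in> V" "v \<in> V" "u \<noteq> v" for u v
    using that by (rule cdist_step)
qed (rule cdist_eq_0_iff cdist_commute cdist_triangle)+


section \<open>The multiset dimension\<close>

lemma card_multiset_resolving_ge:
  assumes "multiset_resolving G W"
  shows "p - 1 \<le> card W"
proof -
  have WV: "W \<subseteq> V" using assms by (simp add: multiset_resolving_def)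
  then have "finite W" using finite_V by (rule finite_subset)
  have "la i \<in> W \<or> lb i \<in> W" if i: "2 \<le> i" "i \<le> p" for i
  proof (rule ccontr)
    assume "\<not> ?thesis"
    then have "cdist (la i) w = cdist (lb i) w" if "w \<in> W" for w
      using that by (cases w rule: vertex_cases) auto
    then have "image_mset (cdist (la i)) (mset_set W) = image_mset (cdist (lb i)) (mset_set W)"
      using \<open>finite W\<close> by (intro image_mset_cong) simp
    then show False
      using assms i multiset_code_G_eq_iff[OF WV, of "la i" "lb i"]
      by (auto simp: multiset_resolving_def)
  qed
  \<comment> \<open>Division by 3 maps a leaf to the position of its neighbour, so the chosen leaves
    cover all of \<open>{2..p}\<close>.\<close>
  then have "{2..p} \<subseteq> (\<lambda>w. w div 3) ` W"
    by (force simp: div_mod_simps)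
  then have "card {2..p} \<le> card ((\<lambda>w. w div 3) ` W)"
    using \<open>finite W\<close> by (intro card_mono) auto
  also have "\<dots> \<le> card W" using \<open>finite W\<close> by (rule card_image_le)
  finally show ?thesis by simp
qed

section \<open>A finite multiset resolving set\<close>

definition W :: "nat set" where "W = sp ` {..L} \<union> la ` {2..p}"

lemma finite_W: "finite W" by (simp add: W_def)

text \<open>The natural-number form of \<open>multiset_code G W\<close>. Vertices are told apart by
  four invariants of it: presence of 0, maximum, sum, and multiplicity of 1.\<close>

definition wcode :: "nat \<Rightarrow> nat multiset" where
  "wcode v = image_mset (cdist v) (mset_set W)"

lemma set_wcode: "set_mset (wcode v) = cdist v ` W"
  by (simp add: wcode_def finite_W)

lemma count_wcode: "count (wcode v) k = card {w \<in> W. cdist v w = k}"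
  using finite_W by (simp add: wcode_def count_image_mset vimage_def Collect_conj_eq Int_commute)

text \<open>Only a vertex itself is at distance 0, and \<open>W\<close> omits exactly the leaves
  \<open>lb i\<close>.\<close>

lemma zero_in_wcode: "v \<in> V \<Longrightarrow> 0 \<in># wcode v \<longleftrightarrow> v \<notin> range lb"
  by (auto elim!: V_cases simp: set_wcode W_def image_iff cdist_eq_0_iff)

text \<open>A farthest element of \<open>W\<close> is an end of the path: no leaf is farther away
  than both ends.\<close>

lemma Max_wcode_sp:
  assumes "x \<le> L"
  shows "Max (set_mset (wcode (sp x))) = max x (L - x)"
proof (rule Max_eqI)
  have "cdist (sp x) (sp 0) = x" "cdist (sp x) (sp L) = L - x" using assms by simp_all
  then show "max x (L - x) \<in> set_mset (wcode (sp x))"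
    unfolding set_wcode W_def max_def by (metis UnI1 atMost_iff image_eqI le0 order_refl)
qed (use assms in \<open>auto simp: set_wcode W_def\<close>)

lemma Max_wcode_la:
  assumes "2 \<le> i" "i \<le> p"
  shows "Max (set_mset (wcode (la i))) = L - i + 1"
proof (rule Max_eqI)
  have "cdist (la i) (sp L) = L - i + 1" using assms by simp
  then show "L - i + 1 \<in> set_mset (wcode (la i))"
    unfolding set_wcode W_def by (metis UnI1 atMost_iff image_eqI order_refl)
qed (use assms in \<open>auto simp: set_wcode W_def\<close>)

lemma Max_wcode_lb:
  assumes "2 \<le> i" "i \<le> p"
  shows "Max (set_mset (wcode (lb i))) = L - i + 1"
proof (rule Max_eqI)
  have "cdist (lb i) (sp L) = L - i + 1" using assms by simp
  then show "L - i + 1 \<in> set_mset (wcode (lb i))"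
    unfolding set_wcode W_def by (metis UnI1 atMost_iff image_eqI order_refl)
qed (use assms in \<open>auto simp: set_wcode W_def\<close>)

lemma sum_wcode_sp:
  "sum_mset (wcode (sp x))
     = (\<Sum>y\<le>L. (x - y) + (y - x)) + (\<Sum>i=2..p. (x - i) + (i - x) + 1)"
proof -
  have "sum_mset (wcode (sp x)) = (\<Sum>w\<in>W. cdist (sp x) w)"
    by (simp add: wcode_def sum_unfold_sum_mset)
  also have "\<dots> = (\<Sum>w\<in>sp ` {..L}. cdist (sp x) w) + (\<Sum>w\<in>la ` {2..p}. cdist (sp x) w)"
    unfolding W_def by (rule sum.union_disjoint) auto
  also have "\<dots> = (\<Sum>y\<le>L. (x - y) + (y - x)) + (\<Sum>i=2..p. (x - i) + (i - x) + 1)"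
    by (subst (1 2) sum.reindex) (simp_all add: inj_on_def)
  finally show ?thesis .
qed

text \<open>The path is symmetric under the reflection of its vertices, but all leaves are in the first half.\<close>

lemma sum_wcode_sp_reflect:
  assumes "x < L - x"
  shows "sum_mset (wcode (sp x)) < sum_mset (wcode (sp (L - x)))"
proof -
  have "(\<Sum>y\<le>L. (x - y) + (y - x)) = (\<Sum>y\<le>L. (L - x - y) + (y - (L - x)))"
    by (rule sum.reindex_bij_witness[of _ "\<lambda>y. L - y" "\<lambda>y. L - y"]) (use assms in auto)
  \<comment> \<open>Both \<open>x\<close> and every \<open>i\<close> in the nonempty range lie in
    the first half, so each \<open>i\<close> is strictly closer to \<open>x\<close> than to
    \<open>L - x\<close>.\<close>
  moreover have "(\<Sum>i=2..p. (x - i) + (i - x) + 1) < (\<Sum>i=2..p. (L - x - i) + (i - (L - x)) + 1)"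
    using p_ge assms by (intro sum_strict_mono) auto
  ultimately show ?thesis unfolding sum_wcode_sp by linarith
qed

text \<open>The maximum fixes \<open>x\<close> up to reflection, and the sum distinguishes the two
  reflected positions.\<close>

lemma wcode_sp_inj:
  assumes "wcode (sp x) = wcode (sp y)" "x \<le> L" "y \<le> L"
  shows "x = y"
proof (rule ccontr)
  assume "x \<noteq> y"
  moreover have "max x (L - x) = max y (L - y)"
    using assms by (metis Max_wcode_sp)
  ultimately have "y = L - x" "x < L - x \<or> y < L - y" "x = L - y"
    using assms(2,3) by (auto simp: max_def split: if_splits)
  then show False
    using sum_wcode_sp_reflect[of x] sum_wcode_sp_reflect[of y] assms(1) by auto
qed

text \<open>A leaf has one neighbour in \<open>W\<close>, an inner path vertex at least two. The
  ends of the path have maximum \<open>L\<close>, which exceeds \<open>L - i + 1\<close>.\<close>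

lemma wcode_sp_neq_la:
  assumes x: "x \<le> L" and i: "2 \<le> i" "i \<le> p"
  shows "wcode (sp x) \<noteq> wcode (la i)"
proof
  assume eq: "wcode (sp x) = wcode (la i)"
  have "{w \<in> W. cdist (la i) w = 1} = {sp i}"
    using i by (auto simp: W_def split: if_splits)
  then have one: "card {w \<in> W. cdist (sp x) w = 1} = 1"
    using arg_cong[OF eq, of "\<lambda>M. count M 1"] unfolding count_wcode by simp
  have "x = 0 \<or> x = L"
  proof (rule ccontr)
    assume "\<not> ?thesis"
    then have "{sp (x - 1), sp (x + 1)} \<subseteq> {w \<in> W. cdist (sp x) w = 1}"
      using x by (auto simp: W_def)
    then have "card {sp (x - 1), sp (x + 1)} \<le> card {w \<in> W. cdist (sp x) w = 1}"
      using finite_W by (intro card_mono) auto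
    with one show False by simp
  qed
  moreover have "max x (L - x) = L - i + 1"
    using eq Max_wcode_sp[OF x] Max_wcode_la[OF i] by simp
  ultimately show False using i by auto
qed

lemma wcode_neq_lb:
  assumes "v \<in> V" "v \<notin> range lb" "2 \<le> i" "i \<le> p"
  shows "wcode v \<noteq> wcode (lb i)"
  using zero_in_wcode[of v] zero_in_wcode[of "lb i"] assms by auto

lemma wcode_la_inj:
  assumes "wcode (la i) = wcode (la j)" "2 \<le> i" "i \<le> p" "2 \<le> j" "j \<le> p"
  shows "i = j"
  using assms Max_wcode_la[of i] Max_wcode_la[of j] by simp

lemma wcode_lb_inj:
  assumes "wcode (lb i) = wcode (lb j)" "2 \<le> i" "i \<le> p" "2 \<le> j" "j \<le> p"
  shows "i = j"
  using assms Max_wcode_lb[of i] Max_wcode_lb[of j] by simp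

lemma wcode_inj: "u \<in> V \<Longrightarrow> v \<in> V \<Longrightarrow> wcode u = wcode v \<Longrightarrow> u = v"
  by (elim V_cases)
    (auto simp: image_iff wcode_sp_neq_la wcode_neq_lb wcode_sp_neq_la[symmetric] wcode_neq_lb[symmetric]
      dest: wcode_sp_inj wcode_la_inj wcode_lb_inj)

lemma multiset_resolving_W: "multiset_resolving G W"
proof -
  have WV: "W \<subseteq> V" by (auto simp: W_def V_def)
  then show ?thesis
    using wcode_inj multiset_code_G_eq_iff[OF WV]
    by (auto simp: multiset_resolving_def wcode_def)
qed

lemma md_G: "\<exists>a. md G = enat a \<and> p - 1 \<le> a"
proof -
  have "md G \<le> enat (card W)"
    unfolding md_def using multiset_resolving_W by (intro INF_lower) simp
  then obtain a where a: "md G = enat a" using enat_ile by blast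
  have "enat (p - 1) \<le> md G"
    unfolding md_def by (intro INF_greatest) (use card_multiset_resolving_ge in auto)
  with a show ?thesis by simp
qed


section \<open>The multiset partition dimension\<close>

definition S1 :: "nat set" where "S1 = {sp 0}"
definition S2 :: "nat set" where "S2 = la ` {2..p}"
text \<open>Twins are separated because \<open>la i\<close> is at distance 1 from this part, through
  \<open>sp i\<close>, while \<open>lb i\<close> is at distance 2 from \<open>S2\<close>.\<close>

definition S3 :: "nat set" where "S3 = lb ` {2..p} \<union> sp ` {1..<L}"
definition S4 :: "nat set" where "S4 = {sp L}"

definition Pi :: "nat set set" where "Pi = {S1, S2, S3, S4}"

lemma partition_on_Pi: "partition_on V Pi"
proof (rule partition_onI)
  have "{..L} = insert 0 (insert L {1..<L})" by auto
  then show "\<Union> Pi = V"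
    by (auto simp: Pi_def S1_def S2_def S3_def S4_def V_def)
  show "{} \<notin> Pi"
    using p_ge by (auto simp: Pi_def S1_def S2_def S3_def S4_def)
  show "disjnt S T" if "S \<in> Pi" "T \<in> Pi" "S \<noteq> T" for S T
    using that by (auto simp: Pi_def S1_def S2_def S3_def S4_def disjnt_iff)
qed

text \<open>Ensures that \<open>mset_set Pi\<close> expands to four separate entries.\<close>

lemma parts_distinct: "S1 \<noteq> S2" "S1 \<noteq> S3" "S1 \<noteq> S4" "S2 \<noteq> S3" "S2 \<noteq> S4" "S3 \<noteq> S4"
proof -
  have "sp 0 \<in> S1" "sp 0 \<notin> S2" "sp 0 \<notin> S3" "sp 0 \<notin> S4" "sp L \<in> S4" "sp L \<notin> S2" "sp L \<notin> S3"
    "sp 1 \<in> S3" "sp 1 \<notin> S2"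
    using p_ge by (auto simp: S1_def S2_def S3_def S4_def)
  then show "S1 \<noteq> S2" "S1 \<noteq> S3" "S1 \<noteq> S4" "S2 \<noteq> S3" "S2 \<noteq> S4" "S3 \<noteq> S4" by blast+
qed

lemma card_Pi: "card Pi = 4"
  using parts_distinct by (simp add: Pi_def)

definition pcode :: "nat \<Rightarrow> nat multiset" where
  "pcode v = image_mset (\<lambda>S. Min (cdist v ` S)) (mset_set Pi)"

lemma pcode_eq:
  "pcode v = {#cdist v (sp 0), Min (cdist v ` S2), Min (cdist v ` S3), cdist v (sp L)#}"
  using parts_distinct by (simp add: pcode_def Pi_def) (simp add: S1_def S4_def)

lemma Min_cdist_eq:
  assumes "finite S" "w \<in> S" "cdist v w = k" "\<And>y. y \<in> S \<Longrightarrow> k \<le> cdist v y"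
  shows "Min (cdist v ` S) = k"
  using assms by (intro Min_eqI) auto

lemma finite_S2: "finite S2" and finite_S3: "finite S3"
  by (simp_all add: S2_def S3_def)

section \<open>Explicit partition codes and their sums\<close>

lemma pcode_la:
  assumes "2 \<le> i" "i \<le> p"
  shows "pcode (la i) = {#i + 1, 0, 1, L - i + 1#}"
proof -
  have "Min (cdist (la i) ` S2) = 0"
    by (rule Min_cdist_eq[OF finite_S2, of "la i"]) (use assms in \<open>auto simp: S2_def\<close>)
  moreover have "Min (cdist (la i) ` S3) = 1"
    by (rule Min_cdist_eq[OF finite_S3, of "sp i"]) (use assms in \<open>auto simp: S3_def\<close>)
  ultimately show ?thesis using assms by (simp add: pcode_eq)
qed

lemma pcode_lb:
  assumes "2 \<le> i" "i \<le> p"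
  shows "pcode (lb i) = {#i + 1, 2, 0, L - i + 1#}"
proof -
  have "Min (cdist (lb i) ` S2) = 2"
    by (rule Min_cdist_eq[OF finite_S2, of "la i"]) (use assms in \<open>auto simp: S2_def\<close>)
  moreover have "Min (cdist (lb i) ` S3) = 0"
    by (rule Min_cdist_eq[OF finite_S3, of "lb i"]) (use assms in \<open>auto simp: S3_def\<close>)
  ultimately show ?thesis using assms by (simp add: pcode_eq)
qed

lemma Min_sp_S2:
  "Min (cdist (sp x) ` S2) = (if x < 2 then 3 - x else if x \<le> p then 1 else x - p + 1)"
  \<comment> \<open>The nearest leaf of \<open>S2\<close> hangs at \<open>x\<close> clamped to the
    range from 2 to \<open>p\<close>.\<close>
  by (rule Min_cdist_eq[OF finite_S2, of "la (if x < 2 then 2 else if x \<le> p then x else p)"])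
    (use p_ge in \<open>auto simp: S2_def\<close>)

lemma Min_sp_S3:
  assumes "x \<le> L"
  shows "Min (cdist (sp x) ` S3) = (if x = 0 \<or> x = L then 1 else 0)"
  by (rule Min_cdist_eq[OF finite_S3, of "sp (if x = 0 then 1 else if x = L then L - 1 else x)"])
    (use p_ge assms in \<open>auto simp: S3_def\<close>)

lemma pcode_sp:
  assumes "x \<le> L"
  shows "pcode (sp x) = {#x, if x < 2 then 3 - x else if x \<le> p then 1 else x - p + 1,
    if x = 0 \<or> x = L then 1 else 0, L - x#}"
  using assms unfolding pcode_eq Min_sp_S2 Min_sp_S3[OF assms] by simp

text \<open>The distances to the two ends add up to \<open>L\<close>; the excess over
  \<open>L\<close> comes from \<open>S2\<close> and \<open>S3\<close> alone. Equal sums leave few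
  candidate positions, which a single entry then rules out.\<close>

lemma sum_pcode_sp:
  assumes "x \<le> L"
  shows "sum_mset (pcode (sp x)) = (if x = 0 then L + 4 else if x = 1 then L + 2
    else if x \<le> p then L + 1 else if x < L then L + 1 + (x - p) else 2 * L + 2 - p)"
  using assms p_ge unfolding pcode_sp[OF assms] by simp

lemma sum_pcode_la: "2 \<le> i \<Longrightarrow> i \<le> p \<Longrightarrow> sum_mset (pcode (la i)) = L + 3"
  by (simp add: pcode_la)

lemma sum_pcode_lb: "2 \<le> i \<Longrightarrow> i \<le> p \<Longrightarrow> sum_mset (pcode (lb i)) = L + 4"
  by (simp add: pcode_lb)

section \<open>Separation of the partition codes\<close>

lemma pcode_sp_neq:
  assumes "x < y" "y \<le> L"
  shows "pcode (sp x) \<noteq> pcode (sp y)"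
proof
  assume eq: "pcode (sp x) = pcode (sp y)"
  have x: "x \<le> L" using assms by simp
  have sums: "sum_mset (pcode (sp x)) = sum_mset (pcode (sp y))" using eq by simp
  consider "x = 0" | "x = 1" | "2 \<le> x" "x \<le> p" | "p < x" by linarith
  then show False
  proof cases
    \<comment> \<open>The sum \<open>L + 4\<close> recurs on the path only at \<open>p + 3\<close>,
      whose entries \<open>p + 3\<close>, 4, 0, \<open>p - 2\<close> do not include 1.\<close>
    case 1
    then have "y = p + 3"
      using sums assms p_ge unfolding sum_pcode_sp[OF x] sum_pcode_sp[OF assms(2)]
      by (simp split: if_splits)
    moreover have "1 \<in># pcode (sp y)"
      unfolding eq[symmetric] pcode_sp[OF x] using 1 by simp
    ultimately show False using p_ge by (simp add: pcode_sp)
  next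
    \<comment> \<open>The sum \<open>L + 2\<close> recurs only at \<open>p + 1\<close>, with entries
      \<open>p + 1\<close>, 2, 0, \<open>p\<close>.\<close>
    case 2
    then have "y = p + 1"
      using sums assms p_ge unfolding sum_pcode_sp[OF x] sum_pcode_sp[OF assms(2)]
      by (simp split: if_splits)
    moreover have "1 \<in># pcode (sp y)"
      unfolding eq[symmetric] pcode_sp[OF x] using 2 by simp
    ultimately show False using p_ge by (simp add: pcode_sp)
  next
    \<comment> \<open>The sum is constant on this range, but the entry \<open>x\<close> is neither 0
      nor 1, differs from \<open>y\<close>, and is less than \<open>L - y\<close>.\<close>
    case 3
    then have y: "y \<le> p"
      using sums assms p_ge unfolding sum_pcode_sp[OF x] sum_pcode_sp[OF assms(2)]
      by (simp split: if_splits)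
    have "x \<in># pcode (sp y)"
      unfolding eq[symmetric] pcode_sp[OF x] by simp
    with y show False using 3 assms by (simp add: pcode_sp)
  next
    \<comment> \<open>Beyond \<open>p\<close> the sum is strictly increasing.\<close>
    case 4
    then show False
      using sums assms p_ge unfolding sum_pcode_sp[OF x] sum_pcode_sp[OF assms(2)]
      by (simp split: if_splits)
  qed
qed

lemma pcode_sp_inj:
  assumes "pcode (sp x) = pcode (sp y)" "x \<le> L" "y \<le> L"
  shows "x = y"
  using assms pcode_sp_neq[of x y] pcode_sp_neq[of y x] by (cases x y rule: linorder_cases) simp_all

text \<open>Only \<open>p + 2\<close> has the same sum as a leaf \<open>la i\<close>, and its
  entries \<open>p + 2\<close>, 3, 0, \<open>p - 1\<close> do not include 1.\<close>

lemma pcode_sp_neq_la: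
  assumes x: "x \<le> L" and i: "2 \<le> i" "i \<le> p"
  shows "pcode (sp x) \<noteq> pcode (la i)"
proof
  assume eq: "pcode (sp x) = pcode (la i)"
  then have "sum_mset (pcode (sp x)) = L + 3" using sum_pcode_la[OF i] by simp
  then have "x = p + 2"
    using x p_ge unfolding sum_pcode_sp[OF x] by (simp split: if_splits)
  moreover have "1 \<in># pcode (sp x)" unfolding eq pcode_la[OF i] by simp
  ultimately show False using p_ge by (simp add: pcode_sp)
qed

text \<open>The sum leaves only the positions 0 and \<open>p + 3\<close>; neither code contains the
  entry 2, the distance from \<open>lb i\<close> to \<open>S2\<close>.\<close>

lemma pcode_sp_neq_lb:
  assumes x: "x \<le> L" and i: "2 \<le> i" "i \<le> p"
  shows "pcode (sp x) \<noteq> pcode (lb i)"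
proof
  assume eq: "pcode (sp x) = pcode (lb i)"
  then have "sum_mset (pcode (sp x)) = L + 4" using sum_pcode_lb[OF i] by simp
  then have "x = 0 \<or> x = p + 3"
    using x p_ge unfolding sum_pcode_sp[OF x] by (simp split: if_splits)
  moreover have "2 \<in># pcode (sp x)" unfolding eq pcode_lb[OF i] by simp
  ultimately show False using p_ge by (auto simp: pcode_sp)
qed

lemma pcode_la_neq_lb:
  assumes "2 \<le> i" "i \<le> p" "2 \<le> j" "j \<le> p"
  shows "pcode (la i) \<noteq> pcode (lb j)"
  using sum_pcode_la[OF assms(1,2)] sum_pcode_lb[OF assms(3,4)] by auto

lemma pcode_la_inj:
  assumes "pcode (la i) = pcode (la j)" "2 \<le> i" "i \<le> p" "2 \<le> j" "j \<le> p"
  shows "i = j"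
proof -
  \<comment> \<open>This entry is at least 3, and it cannot be \<open>L - j + 1\<close> because
    \<open>i + j \<le> 2 * p < L\<close>; so it is \<open>j + 1\<close>.\<close>
  have "i + 1 \<in># pcode (la j)"
    unfolding assms(1)[symmetric] pcode_la[OF assms(2,3)] by simp
  then show ?thesis using assms(2-) by (auto simp: pcode_la)
qed

lemma pcode_lb_inj:
  assumes "pcode (lb i) = pcode (lb j)" "2 \<le> i" "i \<le> p" "2 \<le> j" "j \<le> p"
  shows "i = j"
proof -
  have "i + 1 \<in># pcode (lb j)"
    unfolding assms(1)[symmetric] pcode_lb[OF assms(2,3)] by simp
  then show ?thesis using assms(2-) by (auto simp: pcode_lb)
qed

lemma pcode_inj: "u \<in> V \<Longrightarrow> v \<in> V \<Longrightarrow> pcode u = pcode v \<Longrightarrow> u = v"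
  by (elim V_cases)
    (auto simp: pcode_sp_neq_la pcode_sp_neq_lb pcode_la_neq_lb
      pcode_sp_neq_la[symmetric] pcode_sp_neq_lb[symmetric] pcode_la_neq_lb[symmetric]
      dest: pcode_sp_inj pcode_la_inj pcode_lb_inj)

lemma resolving_multiset_partition_Pi: "resolving_multiset_partition G Pi"
proof -
  have "partition_code G Pi u \<noteq> partition_code G Pi v" if "u \<in> V" "v \<in> V" "u \<noteq> v" for u v
    using pcode_inj[OF that(1,2)] that(3)
    unfolding partition_code_G_eq_iff[OF partition_on_Pi that(1,2)] pcode_def by blast
  then show ?thesis
    unfolding resolving_multiset_partition_def with_proj_simps pverts_G
    using partition_on_Pi by blast
qed

lemma mpd_G: "\<exists>b. mpd G = enat b \<and> b \<le> 4"
proof -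
  have le: "mpd G \<le> enat 4"
    unfolding mpd_def card_Pi[symmetric] using resolving_multiset_partition_Pi by (intro INF_lower) simp
  then obtain b where "mpd G = enat b" using enat_ile by blast
  with le show ?thesis by simp
qed

end

theorem theorem2p2:
  fixes N :: nat
  assumes "N \<ge> 1"
  shows "\<exists>(G :: nat pair_pre_digraph) (a :: nat) (b :: nat).
           pair_graph G \<and> connected (with_proj G) \<and>
           md (with_proj G) = enat a \<and> mpd (with_proj G) = enat b \<and>
           \<bar>int b - int a\<bar> \<ge> int N"
proof -
  \<comment> \<open>With \<open>p = N + 5\<close> the multiset dimension is at least
    \<open>N + 4\<close>, which exceeds the bound 4 on the partition dimension by \<open>N\<close>;
    \<open>N \<ge> 1\<close> gives \<open>6 \<le> p\<close>.\<close>
  interpret caterpillar "N + 5"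
    using assms by unfold_locales simp
  obtain a b where "md G = enat a" "N + 5 - 1 \<le> a" "mpd G = enat b" "b \<le> 4"
    using md_G mpd_G by blast
  moreover from this have "\<bar>int b - int a\<bar> \<ge> int N" by simp
  ultimately show ?thesis
    using pair_graph_G connected_G by blast
qed

end
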